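(* Let $I_p, I_d$ be fixed $n\times n$ real symmetric positive definite matrices. The following hold, including the cases where the values are $\pm\infty$. 1. If $\mathbf{D}$ is asymptotically feasible, then $\lim_{\varepsilon\downarrow 0}v(\varepsilon,0)=v(\mathbf{P})$. 2. If $\mathbf{P}$ is asymptotically feasible, then $\lim_{\eta\downarrow 0}v(0,\eta)=v(\mathbf{D})$.
   Context: Let $\mathcal{S}^n$ be the space of $n\times n$ real symmetric matrices with $U\bullet V=\sum_{i,j} U_{ij}V_{ij}$, and let $\mathcal{S}^n_+$ be the cone of positive semidefinite matrices; $U\succeq 0$ means $U$ is positive semidefinite. Data: $C,A_1,\dots,A_m\in\mathcal{S}^n$, $b\in\mathbb{R}^m$. Problems: $\mathbf{P}$: $\min_X\ C\bullet X$ s.t. $A_i\bullet X=b_i$ ($i=1,\dots,m$), $X\succeq 0$; $\mathbf{D}$: $\max_{y,S}\ b^Ty$ s.t. $C-\sum_i A_iy_i=S$, $S\succeq 0$. $v(\mathbf{P})$, $v(\mathbf{D})$ denote their optimal values. Optimal values are infima/suprema in $[-\infty,+\infty]$ (not necessarily attained); an infeasible minimization problem has value $+\infty$ and an infeasible maximization problem has value $-\infty$. Let $\mathcal{V}=\{X\in\mathcal{S}^n: A_i\bullet X=b_i,\ i=1,\dots,m\}$. $\mathbf{P}$ is weakly infeasible if $\mathcal{V}\cap\mathcal{S}^n_+=\emptyset$ but $0$ belongs to the closure of $\mathcal{S}^n_+-\mathcal{V}$. $\mathbf{P}$ is asymptotically feasible if it is feasible or weakly infeasible. The same notions for $\mathbf{D}$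 are obtained by replacing $\mathcal{V}$ by $\{S\in\mathcal{S}^n:\exists y\in\mathbb{R}^m,\ S=C-\sum_iA_iy_i\}$. For $\varepsilon,\eta\ge 0$ the perturbed problems are $\mathbf{P}(\varepsilon,\eta)$: $\min\ (C+\varepsilon I_d)\bullet X$ s.t. $A_i\bullet X=b_i+\eta A_i\bullet I_p$ ($i=1,\dots,m$), $X\succeq 0$; $\mathbf{D}(\varepsilon,\eta)$: $\max\ \sum_i(b_i+\eta A_i\bullet I_p)y_i$ s.t. $C-\sum_iA_iy_i+\varepsilon I_d=S$, $S\succeq 0$. $v(\varepsilon,\eta)\in[-\infty,+\infty]$ denotes the common optimal value of $\mathbf{P}(\varepsilon,\eta)$ and $\mathbf{D}(\varepsilon,\eta)$ when the two optimal values coincide, and is undefined otherwise. (If $\mathbf{D}$ is asymptotically feasible then $v(\varepsilon,0)$ is defined for every $\varepsilon>0$; if $\mathbf{P}$ is asymptotically feasible then $v(0,\eta)$ is defined for every $\eta>0$.) *)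

theory Defs
  imports "HOL-Analysis.Analysis"
begin

text \<open>
  The trace product \<open>\<Sum>i j. U i j * V i j\<close> of two real matrices is the library inner product
  \<open>U \<bullet> V\<close> on \<open>real^'n^'n\<close>.
\<close>

definition sym_mats :: "(real^'n^'n) set" where
  "sym_mats = {X. transpose X = X}"

definition psd_cone :: "(real^'n^'n) set" where
  "psd_cone = {X \<in> sym_mats. \<forall>v. 0 \<le> v \<bullet> (X *v v)}"

definition pos_def :: "real^'n^'n \<Rightarrow> bool" where
  "pos_def X \<longleftrightarrow> X \<in> sym_mats \<and> (\<forall>v. v \<noteq> 0 \<longrightarrow> 0 < v \<bullet> (X *v v))"

text \<open>
  A semidefinite program is given by \<open>A\<close> (constraint matrices), \<open>b\<close> (right-hand side)
  and \<open>C\<close> (cost matrix).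
\<close>

definition primal_space :: "('m::finite \<Rightarrow> real^'n^'n) \<Rightarrow> real^'m \<Rightarrow> (real^'n^'n) set" where
  "primal_space A b = {X \<in> sym_mats. \<forall>i. A i \<bullet> X = b $ i}"

definition dual_space :: "('m::finite \<Rightarrow> real^'n^'n) \<Rightarrow> real^'n^'n \<Rightarrow> (real^'n^'n) set" where
  "dual_space A C = {S \<in> sym_mats. \<exists>y :: real^'m. S = C - (\<Sum>i\<in>UNIV. y $ i *\<^sub>R A i)}"

text \<open>
  The Minkowski difference of the cone and \<open>\<V>\<close> is written out, because \<open>-\<close> on sets is set
  difference. The closure may be taken among all matrices since \<open>sym_mats\<close> is closed.
\<close>

definition weakly_infeasible :: "(real^'n^'n) set \<Rightarrow> bool" where
  "weakly_infeasible \<V> \<longleftrightarrow>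
     \<V> \<inter> psd_cone = {} \<and> 0 \<in> closure {X - Y | X Y. X \<in> psd_cone \<and> Y \<in> \<V>}"

definition asymptotically_feasible :: "(real^'n^'n) set \<Rightarrow> bool" where
  "asymptotically_feasible \<V> \<longleftrightarrow> \<V> \<inter> psd_cone \<noteq> {} \<or> weakly_infeasible \<V>"

definition primal_value ::
  "('m::finite \<Rightarrow> real^'n^'n) \<Rightarrow> real^'m \<Rightarrow> real^'n^'n \<Rightarrow> ereal" where
  "primal_value A b C =
     (INF X \<in> {X \<in> psd_cone. \<forall>i. A i \<bullet> X = b $ i}. ereal (C \<bullet> X))"

definition dual_value ::
  "('m::finite \<Rightarrow> real^'n^'n) \<Rightarrow> real^'m \<Rightarrow> real^'n^'n \<Rightarrow> ereal" where
  "dual_value A b C =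
     (SUP (y, S) \<in> {(y, S). C - (\<Sum>i\<in>UNIV. y $ i *\<^sub>R A i) = S \<and> S \<in> psd_cone}.
        ereal (b \<bullet> y))"

definition perturbed_rhs ::
  "('m::finite \<Rightarrow> real^'n^'n) \<Rightarrow> real^'m \<Rightarrow> real^'n^'n \<Rightarrow> real \<Rightarrow> real^'m" where
  "perturbed_rhs A b I\<^sub>p \<eta> = (\<chi> i. b $ i + \<eta> * (A i \<bullet> I\<^sub>p))"

definition perturbed_primal_value ::
  "('m::finite \<Rightarrow> real^'n^'n) \<Rightarrow> real^'m \<Rightarrow> real^'n^'n \<Rightarrow> real^'n^'n \<Rightarrow> real^'n^'n \<Rightarrow>
     real \<Rightarrow> real \<Rightarrow> ereal" where
  "perturbed_primal_value A b C I\<^sub>p I\<^sub>d \<epsilon> \<eta> =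
     primal_value A (perturbed_rhs A b I\<^sub>p \<eta>) (C + \<epsilon> *\<^sub>R I\<^sub>d)"

definition perturbed_dual_value ::
  "('m::finite \<Rightarrow> real^'n^'n) \<Rightarrow> real^'m \<Rightarrow> real^'n^'n \<Rightarrow> real^'n^'n \<Rightarrow> real^'n^'n \<Rightarrow>
     real \<Rightarrow> real \<Rightarrow> ereal" where
  "perturbed_dual_value A b C I\<^sub>p I\<^sub>d \<epsilon> \<eta> =
     dual_value A (perturbed_rhs A b I\<^sub>p \<eta>) (C + \<epsilon> *\<^sub>R I\<^sub>d)"

text \<open>The common optimal value is undefined (\<open>None\<close>) when there is a duality gap.\<close>

definition common_value ::
  "('m::finite \<Rightarrow> real^'n^'n) \<Rightarrow> real^'m \<Rightarrow> real^'n^'n \<Rightarrow> real^'n^'n \<Rightarrow> real^'n^'n \<Rightarrow>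
     real \<Rightarrow> real \<Rightarrow> ereal option" where
  "common_value A b C I\<^sub>p I\<^sub>d \<epsilon> \<eta> =
     (if perturbed_primal_value A b C I\<^sub>p I\<^sub>d \<epsilon> \<eta> = perturbed_dual_value A b C I\<^sub>p I\<^sub>d \<epsilon> \<eta>
      then Some (perturbed_primal_value A b C I\<^sub>p I\<^sub>d \<epsilon> \<eta>)
      else None)"

end

theory Submission
  imports Defs
begin

text \<open>
  Asymptotic feasibility of one of the problems makes every perturbation of it strictly feasible, so
  Slater's condition yields strong duality for the perturbed pair. By duality the common value
  can be computed in the problem whose feasible set does not depend on the perturbation: for \<open>v(\<epsilon>, 0)\<close>
  this is the primal, whose objective only gains the term \<open>\<epsilon> I\<^sub>d \<bullet> X \<ge> 0\<close>; for \<open>v(0, \<eta>)\<close> it is the dual,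
  whose objective changes by \<open>\<eta> (C \<bullet> I\<^sub>p - S \<bullet> I\<^sub>p) \<le> \<eta> C \<bullet> I\<^sub>p\<close>. Both limits follow by interchanging
  infima (suprema).
\<close>

section \<open>Rank-one matrices, symmetric matrices and the semidefinite cone\<close>

definition outer :: "real^'n \<Rightarrow> real^'n^'n" where
  "outer v = (\<chi> i j. v $ i * v $ j)"

text \<open>Lets quadratic forms be handled as trace products; the self-duality of the cone and the
  norm bound on quadratic forms both rest on it.\<close>

lemma inner_outer: "M \<bullet> outer v = v \<bullet> (M *v v)"
  by (simp add: outer_def inner_vec_def matrix_vector_mult_def sum_distrib_left mult_ac)

lemma outer_mult: "outer v *v w = (v \<bullet> w) *\<^sub>R v"
  by (simp add: outer_def vec_eq_iff inner_vec_def matrix_vector_mult_def sum_distrib_left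
      sum_distrib_right mult_ac)

lemma sym_mats_iff: "X \<in> sym_mats \<longleftrightarrow> (\<forall>i j. X $ i $ j = X $ j $ i)"
  by (auto simp: sym_mats_def transpose_def vec_eq_iff)

text \<open>Besides giving the closure rules below, this makes a separating matrix symmetric when it
  is chosen in the span of symmetric matrices.\<close>

lemma subspace_sym_mats: "subspace sym_mats"
  by (auto simp: subspace_def sym_mats_iff)

lemmas sym_mats_intros =
  subspace_add[OF subspace_sym_mats] subspace_diff[OF subspace_sym_mats]
  subspace_scale[OF subspace_sym_mats] subspace_sum[OF subspace_sym_mats]
  subspace_0[OF subspace_sym_mats]

lemma psd_cone_iff: "X \<in> psd_cone \<longleftrightarrow> X \<in> sym_mats \<and> (\<forall>v. 0 \<le> v \<bullet> (X *v v))"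
  by (simp add: psd_cone_def)

lemma psd_sym: "X \<in> psd_cone \<Longrightarrow> X \<in> sym_mats"
  by (simp add: psd_cone_def)

lemma outer_psd: "outer v \<in> psd_cone"
  by (auto simp: psd_cone_iff sym_mats_iff outer_mult inner_commute) (auto simp: outer_def)

lemma psd_0: "0 \<in> psd_cone"
  by (simp add: psd_cone_iff sym_mats_intros)

lemma psd_add: "X \<in> psd_cone \<Longrightarrow> Y \<in> psd_cone \<Longrightarrow> X + Y \<in> psd_cone"
  by (simp add: psd_cone_iff sym_mats_intros matrix_vector_mult_add_rdistrib inner_add_right)

lemma psd_scale: "X \<in> psd_cone \<Longrightarrow> 0 \<le> c \<Longrightarrow> c *\<^sub>R X \<in> psd_cone"
  by (simp add: psd_cone_iff sym_mats_intros scaleR_matrix_vector_assoc[symmetric])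

text \<open>The easy half of the self-duality of the cone: testing against \<open>outer v\<close>
  alone recovers the quadratic form.\<close>

lemma psd_of_inner_nonneg:
  assumes "X \<in> sym_mats" and "\<And>S. S \<in> psd_cone \<Longrightarrow> 0 \<le> X \<bullet> S"
  shows "X \<in> psd_cone"
  using assms(2)[OF outer_psd] by (simp add: psd_cone_iff assms(1) inner_outer)

section \<open>Cauchy-Schwarz for semidefinite forms and nonnegative trace products\<close>

lemma quadratic_form_axis: "axis k 1 \<bullet> (X *v v) = (X *v v) $ k" for X :: "real^'n^'n"
  by (simp add: inner_axis' )

lemma sym_mult_inner:
  assumes "S \<in> sym_mats"
  shows "v \<bullet> (S *v w) = (S *v v) \<bullet> w"
  using dot_lmul_matrix[of v S w] transpose_matrix_vector[of S v] assms
  by (metis (mono_tags, lifting) mem_Collect_eq sym_mats_def)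

text \<open>The form restricted to combinations of \<open>v\<close> and \<open>w\<close> is a
  nonnegative binary quadratic form, so its discriminant has a sign. As the form may degenerate,
  \<open>c = 0\<close> is treated apart.\<close>

lemma psd_quadratic_form_Cauchy_Schwarz:
  assumes S: "S \<in> psd_cone"
  shows "(v \<bullet> (S *v w))\<^sup>2 \<le> (v \<bullet> (S *v v)) * (w \<bullet> (S *v w))"
proof -
  define a where "a = v \<bullet> (S *v v)"
  define h where "h = v \<bullet> (S *v w)"
  define c where "c = w \<bullet> (S *v w)"
  have h': "w \<bullet> (S *v v) = h"
    using sym_mult_inner[OF psd_sym[OF S], of w v] by (simp add: h_def inner_commute)
  have q: "0 \<le> s\<^sup>2 * a + 2 * s * t * h + t\<^sup>2 * c" for s t
  proof -
    have "0 \<le> (s *\<^sub>R v + t *\<^sub>R w) \<bullet> (S *v (s *\<^sub>R v + t *\<^sub>R w))"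
      using S by (simp add: psd_cone_iff)
    also have "\<dots> = s\<^sup>2 * a + 2 * s * t * h + t\<^sup>2 * c"
      by (simp add: matrix_vector_right_distrib matrix_vector_mult_scaleR inner_add_left
          inner_add_right h' flip: a_def h_def c_def) (simp add: algebra_simps power2_eq_square)
    finally show ?thesis .
  qed
  have ac: "0 \<le> a" "0 \<le> c" using S by (auto simp: a_def c_def psd_cone_iff)
  have "h\<^sup>2 \<le> a * c"
  proof (cases "c = 0")
    case True
    have "0 \<le> a - 2 * h * s" for s
      using q[of 1 "- s"] True by (simp add: mult_ac)
    \<comment> \<open>For \<open>h \<noteq> 0\<close> this value of \<open>s\<close> makes
      \<open>a - 2 * h * s\<close> equal to -1.\<close>
    from this[of "(a + 1) / (2 * h)"] show ?thesis
      using True by (cases "h = 0") auto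
  next
    case False
    then have "c > 0" using ac by simp
    \<comment> \<open>With \<open>s = c\<close> fixed, \<open>t = - h\<close> minimizes the binary
      form; the minimum is the right-hand side.\<close>
    have "0 \<le> c * (a * c - h\<^sup>2)"
      using q[of c "- h"] by (simp add: algebra_simps power2_eq_square)
    with \<open>c > 0\<close> show ?thesis by (simp add: zero_le_mult_iff)
  qed
  then show ?thesis by (simp add: a_def h_def c_def)
qed

lemma mult_axis_nth: "(S *v axis k 1) $ i = S $ i $ k" for S :: "real^'n^'n"
  by (simp add: matrix_vector_mult_basis column_def)

lemma psd_diag_nonneg: "S \<in> psd_cone \<Longrightarrow> 0 \<le> S $ k $ k"
  using quadratic_form_axis[of k S "axis k 1"] by (simp add: psd_cone_iff mult_axis_nth) metis

text \<open>Principal minors of order two are nonnegative. In particular a zero diagonal entry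
  forces its whole row and column to vanish.\<close>

lemma psd_entry_square_le:
  assumes "S \<in> psd_cone"
  shows "(S $ i $ k)\<^sup>2 \<le> S $ i $ i * S $ k $ k"
  using psd_quadratic_form_Cauchy_Schwarz[OF assms, of "axis i 1" "axis k 1"]
  by (simp add: quadratic_form_axis mult_axis_nth)

text \<open>Subtracting the rank-one Cholesky term of a nonzero diagonal entry of \<open>S\<close> keeps \<open>S\<close>
  positive semidefinite and annihilates that entry.\<close>

lemma psd_inner_nonneg:
  assumes X: "X \<in> psd_cone" and "S \<in> psd_cone"
  shows "0 \<le> X \<bullet> S"
  using assms(2)
proof (induction "card {i. S $ i $ i \<noteq> 0}" arbitrary: S rule: less_induct)
  case less
  note S = \<open>S \<in> psd_cone\<close>
  show ?case
  proof (cases "\<exists>k. S $ k $ k \<noteq> 0")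
    case False
    then have "S = 0"
      using psd_entry_square_le[OF S] by (simp add: vec_eq_iff)
    then show ?thesis by simp
  next
    case True
    then obtain k where k: "S $ k $ k \<noteq> 0" by blast
    define c where "c = S $ k $ k"
    define w where "w = S *v axis k 1"
    define T where "T = S - (1 / c) *\<^sub>R outer w"
    have c: "c > 0" using psd_diag_nonneg[OF S, of k] k by (simp add: c_def)
    have wn: "w $ i = S $ i $ k" for i by (simp add: w_def mult_axis_nth)
    have wk: "v \<bullet> (S *v axis k 1) = v \<bullet> w" for v by (simp add: w_def)
    have T: "T \<in> psd_cone"
      unfolding psd_cone_iff
    proof (intro conjI allI)
      show "T \<in> sym_mats"
        unfolding T_def by (intro sym_mats_intros psd_sym S outer_psd)
      fix v
      \<comment> \<open>Cauchy-Schwarz against the axis vector of index \<open>k\<close>, divided by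
        \<open>c\<close>, says exactly that the Schur complement \<open>T\<close> is
        semidefinite.\<close>
      have "(v \<bullet> w)\<^sup>2 \<le> (v \<bullet> (S *v v)) * c"
        using psd_quadratic_form_Cauchy_Schwarz[OF S, of v "axis k 1"]
        by (simp add: wk inner_axis' wn c_def)
      then have "(v \<bullet> w)\<^sup>2 / c \<le> v \<bullet> (S *v v)"
        using c by (simp add: field_simps)
      then show "0 \<le> v \<bullet> (T *v v)"
        by (simp add: T_def matrix_vector_mult_diff_rdistrib inner_diff_right outer_mult
            scaleR_matrix_vector_assoc[symmetric] power2_eq_square inner_commute)
    qed
    have Td: "T $ i $ i = S $ i $ i - (S $ i $ k)\<^sup>2 / c" for i
      by (simp add: T_def outer_def wn power2_eq_square)
    \<comment> \<open>Zeros on the diagonal persist and the entry at \<open>k\<close> becomes a new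
      one, so the induction measure drops.\<close>
    have "T $ i $ i = 0" if "S $ i $ i = 0" for i
      using psd_entry_square_le[OF S, of i k] that by (simp add: Td)
    moreover have "T $ k $ k = 0"
      using c by (simp add: Td c_def power2_eq_square)
    ultimately have "{i. T $ i $ i \<noteq> 0} \<subset> {i. S $ i $ i \<noteq> 0}"
      using k by blast
    then have "card {i. T $ i $ i \<noteq> 0} < card {i. S $ i $ i \<noteq> 0}"
      by (intro psubset_card_mono) auto
    then have "0 \<le> X \<bullet> T" using less.hyps T by blast
    moreover have "0 \<le> X \<bullet> outer w" using X by (simp add: inner_outer psd_cone_iff)
    moreover have "S = T + (1 / c) *\<^sub>R outer w" by (simp add: T_def)
    ultimately show ?thesis using c by (simp add: inner_add_right)
  qed
qed

section \<open>Positive definite matrices as interior points of the cone\<close>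

lemma norm_outer: "norm (outer v) = (norm v)\<^sup>2"
  by (simp add: norm_eq_sqrt_inner[of "outer v"] inner_outer outer_mult power2_norm_eq_inner)

lemma quadratic_form_le: "v \<bullet> (U *v v) \<le> norm U * (norm v)\<^sup>2"
  for U :: "real^'n^'n"
  using norm_cauchy_schwarz[of U "outer v"] by (simp add: inner_outer norm_outer)

text \<open>The form attains a positive minimum on the compact unit sphere, and homogeneity carries
  the bound to all vectors.\<close>

lemma pos_def_coercive:
  assumes "pos_def (P :: real^'n^'n)"
  obtains c where "c > 0" "\<And>v. c * (norm v)\<^sup>2 \<le> v \<bullet> (P *v v)"
proof -
  define S where "S = sphere (0 :: real^'n) 1"
  have "compact S" by (simp add: S_def)
  \<comment> \<open>Any index would do: the sphere must be nonempty for the minimum to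
    exist.\<close>
  moreover have "axis undefined 1 \<in> S" by (simp add: S_def)
  moreover have "continuous_on S (\<lambda>v. v \<bullet> (P *v v))"
    by (intro continuous_intros linear_continuous_on matrix_vector_mul_bounded_linear)
  ultimately obtain u where u: "u \<in> S" "\<And>v. v \<in> S \<Longrightarrow> u \<bullet> (P *v u) \<le> v \<bullet> (P *v v)"
    using continuous_attains_inf[of S "\<lambda>v. v \<bullet> (P *v v)"] by blast
  define c where "c = u \<bullet> (P *v u)"
  have "u \<noteq> 0" using u(1) by (auto simp: S_def)
  then have "c > 0" using assms by (simp add: c_def pos_def_def)
  moreover have "c * (norm v)\<^sup>2 \<le> v \<bullet> (P *v v)" for v
  proof (cases "v = 0")
    case False
    have "(1 / norm v) *\<^sub>R v \<in> S" using False by (simp add: S_def)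
    from u(2)[OF this] have "c \<le> (1 / norm v)\<^sup>2 * (v \<bullet> (P *v v))"
      by (simp add: c_def matrix_vector_mult_scaleR power2_eq_square)
    then show ?thesis using False by (simp add: field_simps)
  qed simp
  ultimately show ?thesis using that by blast
qed

text \<open>A symmetric \<open>U\<close> with norm below the coercivity constant cannot cancel the
  form of \<open>P\<close>, since its own form is bounded by its norm.\<close>

lemma pos_def_perturb:
  assumes "pos_def P"
  obtains d where "d > 0" "\<And>U. U \<in> sym_mats \<Longrightarrow> norm U < d \<Longrightarrow> pos_def (P - U)"
proof -
  obtain c where c: "c > 0" "\<And>v. c * (norm v)\<^sup>2 \<le> v \<bullet> (P *v v)"
    using pos_def_coercive[OF assms] by blast
  have "pos_def (P - U)" if U: "U \<in> sym_mats" "norm U < c" for U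
    unfolding pos_def_def
  proof (intro conjI allI impI)
    show "P - U \<in> sym_mats" using assms U by (simp add: pos_def_def sym_mats_intros)
    fix v :: "real^'a" assume "v \<noteq> 0"
    then have "norm U * (norm v)\<^sup>2 < c * (norm v)\<^sup>2"
      using U by (intro mult_strict_right_mono) auto
    with quadratic_form_le[of v U] c(2)[of v] show "0 < v \<bullet> ((P - U) *v v)"
      by (simp add: matrix_vector_mult_diff_rdistrib inner_diff_right)
  qed
  with c(1) show ?thesis using that by blast
qed

lemma pos_def_psd: "pos_def P \<Longrightarrow> P \<in> psd_cone"
  unfolding pos_def_def psd_cone_iff by (metis inner_zero_left less_imp_le order_refl)

lemma psd_add_pos_def: "X \<in> psd_cone \<Longrightarrow> pos_def P \<Longrightarrow> pos_def (X + P)"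
  by (auto simp: pos_def_def psd_cone_iff sym_mats_intros matrix_vector_mult_add_rdistrib
      inner_add_right intro: add_nonneg_pos)

lemma pos_def_scale: "pos_def P \<Longrightarrow> 0 < c \<Longrightarrow> pos_def (c *\<^sub>R P)"
  by (simp add: pos_def_def sym_mats_intros scaleR_matrix_vector_assoc[symmetric])

text \<open>Allows a short step from a strictly feasible point in any symmetric direction; this is
  how Slater's condition enters the separation arguments.\<close>

lemma pos_def_minus_scaled_psd:
  assumes "pos_def P" and "U \<in> sym_mats"
  obtains d where "d > 0" "P - d *\<^sub>R U \<in> psd_cone"
proof -
  obtain e where e: "e > 0" "\<And>U. U \<in> sym_mats \<Longrightarrow> norm U < e \<Longrightarrow> pos_def (P - U)"
    using pos_def_perturb[OF assms(1)] by blast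
  \<comment> \<open>Adding 1 keeps the denominator positive for \<open>U = 0\<close>; the factor 2
    makes the norm bound strict.\<close>
  define d where "d = e / (2 * (norm U + 1))"
  have n: "0 < norm U + 1" by (simp add: add_nonneg_pos)
  have d: "d > 0" using e(1) n by (simp add: d_def)
  have "norm (d *\<^sub>R U) \<le> d * (norm U + 1)" using d by simp
  also have "\<dots> = e / 2" using n by (simp add: d_def field_simps)
  also have "\<dots> < e" using e(1) by simp
  finally have "P - d *\<^sub>R U \<in> psd_cone"
    using e(2) assms(2) by (intro pos_def_psd) (simp add: sym_mats_intros)
  with d show ?thesis using that by blast
qed

section \<open>Weak and strong duality\<close>

text \<open>A negative \<open>x\<close> would drive \<open>s * x\<close> below any bound. This turns
  bounds along the rays of a cone into sign conditions.\<close>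

lemma nonneg_if_scaled_bounded_below:
  fixes x :: real
  assumes "\<And>s. 0 < s \<Longrightarrow> k \<le> s * x"
  shows "0 \<le> x"
proof (rule ccontr)
  assume "\<not> 0 \<le> x"
  then have "k \<le> - \<bar>k\<bar> - 1"
    using assms[of "(- \<bar>k\<bar> - 1) / x"] by (simp add: divide_neg_neg)
  then show False by linarith
qed

lemma inner_constraint_sum:
  assumes "\<And>i. A i \<bullet> X = b $ i"
  shows "X \<bullet> (\<Sum>i\<in>UNIV. y $ i *\<^sub>R A i) = b \<bullet> y"
  using assms by (simp add: inner_sum_right inner_vec_def[of b] inner_commute[of X] mult.commute)

text \<open>The gap between two feasible objective values is the trace product of the primal matrix
  with the dual slack.\<close>

lemma weak_duality: "dual_value A b C \<le> primal_value A b C"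
  unfolding dual_value_def primal_value_def
proof (rule SUP_least, rule INF_greatest, clarsimp)
  fix y X
  assume S: "C - (\<Sum>i\<in>UNIV. y $ i *\<^sub>R A i) \<in> psd_cone" and X: "X \<in> psd_cone" "\<forall>i. A i \<bullet> X = b $ i"
  have "0 \<le> X \<bullet> (C - (\<Sum>i\<in>UNIV. y $ i *\<^sub>R A i))" by (rule psd_inner_nonneg[OF X(1) S])
  also have "\<dots> = C \<bullet> X - b \<bullet> y"
    using inner_constraint_sum[of A X b y] X(2) by (simp add: inner_diff_right inner_commute)
  finally show "b \<bullet> y \<le> C \<bullet> X" by simp
qed

lemma primal_value_le: "X \<in> psd_cone \<Longrightarrow> (\<And>i. A i \<bullet> X = b $ i) \<Longrightarrow> primal_value A b C \<le> ereal (C \<bullet> X)"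
  unfolding primal_value_def by (rule INF_lower) simp

lemma dual_value_ge:
  assumes "C - (\<Sum>i\<in>UNIV. y $ i *\<^sub>R A i) \<in> psd_cone"
  shows "ereal (b \<bullet> y) \<le> dual_value A b C"
  unfolding dual_value_def
  by (rule SUP_upper2[of "(y, C - (\<Sum>i\<in>UNIV. y $ i *\<^sub>R A i))"]) (use assms in auto)

text \<open>Since \<open>b\<close> lies in the range of the constraint map, so does the multiplier when it is chosen
  in the span of the separated set; this replaces linear independence of the \<open>A i\<close>.\<close>

lemma strong_duality_primal_interior:
  fixes A :: "'m::finite \<Rightarrow> real^'n^'n"
  assumes C: "C \<in> sym_mats" and A: "\<And>i. A i \<in> sym_mats"
    and X0: "pos_def X0" "\<And>i. A i \<bullet> X0 = b $ i"
  shows "primal_value A b C = dual_value A b C"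
proof (rule antisym[OF _ weak_duality])
  show "primal_value A b C \<le> dual_value A b C"
  proof (cases "primal_value A b C")
    case PInf
    then show ?thesis using primal_value_le[of X0 A b C] X0 pos_def_psd by auto
  next
    case MInf
    then show ?thesis by simp
  next
    case (real p)
    define L where "L X = (\<chi> i. A i \<bullet> X)" for X
    have linL: "linear L"
      by (auto simp: linear_iff L_def vec_eq_iff inner_add_right)
    have LX0: "L X0 = b" using X0 by (simp add: L_def vec_eq_iff)
    have adj: "z \<bullet> L X = (\<Sum>i\<in>UNIV. z $ i *\<^sub>R A i) \<bullet> X" for z X
      by (simp add: L_def inner_vec_def[of z] inner_sum_left)
    have p: "p \<le> C \<bullet> X" if "X \<in> psd_cone" "L X = b" for X
      using primal_value_le[of X A b C] that real by (auto simp: L_def vec_eq_iff)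
    \<comment> \<open>Constraint residual paired with cost excess over \<open>p\<close>. The strict
      slack \<open>r > 0\<close> keeps 0 out of \<open>M\<close>: otherwise some feasible
      \<open>X\<close> would cost less than \<open>p\<close>.\<close>
    define M where "M = {(L X - b, C \<bullet> X - p + r) | X r. X \<in> psd_cone \<and> 0 < r}"
    have "convex M"
      unfolding convex_alt
    proof (intro ballI allI impI, elim conjE)
      fix x y and u :: real
      assume x: "x \<in> M" and y: "y \<in> M" and u: "0 \<le> u" "u \<le> 1"
      from x obtain X r where x: "x = (L X - b, C \<bullet> X - p + r)" "X \<in> psd_cone" "0 < r"
        by (auto simp: M_def)
      from y obtain Y s where y: "y = (L Y - b, C \<bullet> Y - p + s)" "Y \<in> psd_cone" "0 < s"
        by (auto simp: M_def)
      define Z where "Z = (1 - u) *\<^sub>R X + u *\<^sub>R Y"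
      define t where "t = (1 - u) * r + u * s"
      have "Z \<in> psd_cone" using x y u by (simp add: Z_def psd_add psd_scale)
      moreover have "0 < t"
        using convexD[OF convex_real_interval(3)[of 0], of r s "1 - u" u] x y u by (simp add: t_def)
      moreover have "(1 - u) *\<^sub>R x + u *\<^sub>R y = (L Z - b, C \<bullet> Z - p + t)"
        by (simp add: x y Z_def t_def linear_add[OF linL] linear_diff[OF linL] linear_scale[OF linL] inner_add_right
            algebra_simps)
      ultimately show "(1 - u) *\<^sub>R x + u *\<^sub>R y \<in> M" by (auto simp: M_def)
    qed
    moreover have "(L 0 - b, C \<bullet> 0 - p + 1) \<in> M"
      unfolding M_def using psd_0 zero_less_one by blast
    moreover have "0 \<notin> M" using p by (force simp: M_def zero_prod_def)
    ultimately obtain a where a: "a \<in> span M" "a \<noteq> 0" "\<And>x. x \<in> M \<Longrightarrow> 0 \<le> a \<bullet> x"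
      using separating_hyperplane_set_0_inspan[of M] by blast
    obtain z t where zt: "a = (z, t)" by (cases a)
    have sep: "0 \<le> z \<bullet> (L X - b) + t * (C \<bullet> X - p + r)" if "X \<in> psd_cone" "0 < r" for X r
      using a(3)[of "(L X - b, C \<bullet> X - p + r)"] that by (auto simp: M_def zt)
    have "M \<subseteq> range L \<times> UNIV"
    proof
      fix x assume "x \<in> M"
      then obtain X r where x: "x = (L X - b, C \<bullet> X - p + r)"
        by (auto simp: M_def)
      have "L X - b = L (X - X0)" by (simp add: linear_diff[OF linL] LX0)
      then show "x \<in> range L \<times> UNIV" by (simp add: x)
    qed
    moreover have "subspace (range L \<times> (UNIV :: real set))"
      by (intro subspace_Times linear_subspace_image linL subspace_UNIV)
    ultimately have "span M \<subseteq> range L \<times> UNIV" by (rule span_minimal)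
    then obtain W where W: "z = L W" using a(1) zt by auto
    have "0 \<le> t"
    proof (rule nonneg_if_scaled_bounded_below)
      fix s :: real assume "0 < s"
      from sep[OF psd_0 this] show "- (z \<bullet> (L 0 - b) + t * (C \<bullet> 0 - p)) \<le> s * t"
        by (simp add: algebra_simps)
    qed
    moreover have "t \<noteq> 0"
    proof
      assume t: "t = 0"
      \<comment> \<open>\<open>U\<close> is the adjoint of the constraint map at \<open>z\<close>.
        Stepping from \<open>X0\<close> along \<open>- U\<close> stays in the cone and forces
        \<open>U = 0\<close>; then \<open>z = L W\<close> gives \<open>z = 0\<close>.\<close>
      define U where "U = (\<Sum>i\<in>UNIV. z $ i *\<^sub>R A i)"
      have "U \<in> sym_mats" unfolding U_def by (intro sym_mats_intros A)
      then obtain d where d: "d > 0" "X0 - d *\<^sub>R U \<in> psd_cone"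
        using pos_def_minus_scaled_psd[OF X0(1)] by blast
      have "0 \<le> z \<bullet> (L (X0 - d *\<^sub>R U) - b)" using sep[OF d(2) zero_less_one] t by simp
      also have "\<dots> = - d * (U \<bullet> U)"
        by (simp add: linear_diff[OF linL] linear_scale[OF linL] LX0 adj flip: U_def)
      finally have "U \<bullet> U \<le> 0" using d(1) by (simp add: mult_le_0_iff)
      then have "U = 0" using inner_ge_zero[of U] inner_eq_zero_iff[of U] by linarith
      moreover have "z \<bullet> z = U \<bullet> W" using adj[of z W] W by (simp add: U_def)
      ultimately have "z = 0" by simp
      with t a(2) zt show False by (simp add: zero_prod_def)
    qed
    ultimately have t: "t > 0" by simp
    \<comment> \<open>Scaling the cost coefficient of the hyperplane to 1 turns \<open>z\<close>
      into a dual multiplier, up to sign.\<close>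
    define y where "y = - (1 / t) *\<^sub>R z"
    define S where "S = C - (\<Sum>i\<in>UNIV. y $ i *\<^sub>R A i)"
    \<comment> \<open>Used twice: along rays of the cone it makes \<open>S\<close> semidefinite, and
      at \<open>X = 0\<close> it gives \<open>p \<le> b \<bullet> y\<close>. Letting the slack
      \<open>r\<close> tend to 0 removes it.\<close>
    have SX: "p - b \<bullet> y \<le> S \<bullet> X" if X: "X \<in> psd_cone" for X
    proof (rule field_le_epsilon)
      fix e :: real assume "0 < e"
      have "0 \<le> (z \<bullet> (L X - b) + t * (C \<bullet> X - p + e)) / t"
        using sep[OF X \<open>0 < e\<close>] t by simp
      also have "\<dots> = - (y \<bullet> (L X - b)) + (C \<bullet> X - p + e)"
        using t by (simp add: y_def add_divide_distrib)
      also have "\<dots> = S \<bullet> X + b \<bullet> y - p + e"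
        by (simp add: S_def inner_diff_right inner_diff_left adj inner_commute)
      finally show "p - b \<bullet> y \<le> S \<bullet> X + e" by simp
    qed
    have "S \<in> psd_cone"
    proof (rule psd_of_inner_nonneg)
      show "S \<in> sym_mats" unfolding S_def by (intro sym_mats_intros A C)
      fix X :: "real^'n^'n" assume X: "X \<in> psd_cone"
      show "0 \<le> S \<bullet> X"
      proof (rule nonneg_if_scaled_bounded_below)
        fix s :: real assume "0 < s"
        then show "p - b \<bullet> y \<le> s * (S \<bullet> X)" using SX[OF psd_scale[OF X, of s]] by simp
      qed
    qed
    then have "ereal (b \<bullet> y) \<le> dual_value A b C" unfolding S_def by (rule dual_value_ge)
    moreover have "p \<le> b \<bullet> y" using SX[OF psd_0] by simp
    ultimately show ?thesis using real by (metis ereal_less_eq(3) order_trans)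
  qed
qed

text \<open>Separation with the roles exchanged: the separating matrix, rescaled, is a primal
  feasible point whose cost is at most the dual value.\<close>

lemma strong_duality_dual_interior:
  fixes A :: "'m::finite \<Rightarrow> real^'n^'n"
  assumes C: "C \<in> sym_mats" and A: "\<And>i. A i \<in> sym_mats"
    and y0: "pos_def (C - (\<Sum>i\<in>UNIV. y0 $ i *\<^sub>R A i))"
  shows "primal_value A b C = dual_value A b C"
proof (rule antisym[OF _ weak_duality])
  show "primal_value A b C \<le> dual_value A b C"
  proof (cases "dual_value A b C")
    case PInf
    then show ?thesis by simp
  next
    case MInf
    then show ?thesis using dual_value_ge[OF pos_def_psd[OF y0], of b] by auto
  next
    case (real p)
    define L where "L y = (\<Sum>i\<in>UNIV. y $ i *\<^sub>R A i)" for y :: "real^'m"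
    have linL: "linear L"
      by (auto simp: linear_iff L_def sum.distrib scaleR_sum_right algebra_simps)
    have Lsym: "L y \<in> sym_mats" for y
      unfolding L_def by (intro sym_mats_intros A)
    have p: "b \<bullet> y \<le> p" if "C - L y \<in> psd_cone" for y
      using dual_value_ge[of C y A b] that real by (simp add: L_def)
    \<comment> \<open>Residual of the slack equation paired with the shortfall from
      \<open>p\<close>. If 0 were in \<open>M\<close>, some dual feasible \<open>y\<close> would
      have objective \<open>p + r\<close>.\<close>
    define M where "M = {(S - C + L y, r - b \<bullet> y + p) | S y r. S \<in> psd_cone \<and> 0 < r}"
    have "convex M"
      unfolding convex_alt
    proof (intro ballI allI impI, elim conjE)
      fix m m' and u :: real
      assume m: "m \<in> M" "m' \<in> M" and u: "0 \<le> u" "u \<le> 1"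
      from m(1) obtain S y r where x: "m = (S - C + L y, r - b \<bullet> y + p)" "S \<in> psd_cone" "0 < r"
        by (auto simp: M_def)
      from m(2) obtain T w s where y: "m' = (T - C + L w, s - b \<bullet> w + p)" "T \<in> psd_cone" "0 < s"
        by (auto simp: M_def)
      define Z where "Z = (1 - u) *\<^sub>R S + u *\<^sub>R T"
      define v where "v = (1 - u) *\<^sub>R y + u *\<^sub>R w"
      define t where "t = (1 - u) * r + u * s"
      have "Z \<in> psd_cone" using x y u by (simp add: Z_def psd_add psd_scale)
      moreover have "0 < t"
        using convexD[OF convex_real_interval(3)[of 0], of r s "1 - u" u] x y u by (simp add: t_def)
      moreover have "(1 - u) *\<^sub>R m + u *\<^sub>R m' = (Z - C + L v, t - b \<bullet> v + p)"
        by (simp add: x y Z_def t_def v_def linear_add[OF linL] linear_diff[OF linL] linear_scale[OF linL]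
            inner_add_right algebra_simps)
      ultimately show "(1 - u) *\<^sub>R m + u *\<^sub>R m' \<in> M" by (auto simp: M_def)
    qed
    moreover have "(0 - C + L 0, 1 - b \<bullet> 0 + p) \<in> M"
      unfolding M_def using psd_0 zero_less_one by blast
    moreover have "0 \<notin> M"
    proof
      assume "0 \<in> M"
      then obtain S y r where *: "S - C + L y = 0" "r - b \<bullet> y + p = 0" "S \<in> psd_cone" "0 < r"
        by (auto simp: M_def zero_prod_def)
      then have "C - L y = S" by (simp add: algebra_simps)
      with * have "C - L y \<in> psd_cone" by simp
      with p[of y] * show False by simp
    qed
    ultimately obtain a where a: "a \<in> span M" "a \<noteq> 0" "\<And>x. x \<in> M \<Longrightarrow> 0 \<le> a \<bullet> x"
      using separating_hyperplane_set_0_inspan[of M] by blast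
    obtain X t where Xt: "a = (X, t)" by (cases a)
    have sep: "0 \<le> X \<bullet> (S - C + L y) + t * (r - b \<bullet> y + p)" if "S \<in> psd_cone" "0 < r" for S y r
      using a(3)[of "(S - C + L y, r - b \<bullet> y + p)"] that by (auto simp: M_def Xt)
    have "M \<subseteq> sym_mats \<times> UNIV"
    proof
      fix x assume "x \<in> M"
      then obtain S y r where x: "x = (S - C + L y, r - b \<bullet> y + p)" and S: "S \<in> psd_cone"
        by (auto simp: M_def)
      have "S - C + L y \<in> sym_mats" by (intro sym_mats_intros psd_sym[OF S] C Lsym)
      then show "x \<in> sym_mats \<times> UNIV" by (simp add: x)
    qed
    moreover have "subspace (sym_mats \<times> (UNIV :: real set))"
      by (intro subspace_Times subspace_sym_mats subspace_UNIV)
    ultimately have "span M \<subseteq> sym_mats \<times> UNIV" by (rule span_minimal)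
    then have Xsym: "X \<in> sym_mats" using a(1) Xt by auto
    have "0 \<le> t"
    proof (rule nonneg_if_scaled_bounded_below)
      fix s :: real assume "0 < s"
      from sep[OF psd_0 this, of 0] show "- (X \<bullet> (0 - C + L 0) + t * p) \<le> s * t"
        by (simp add: algebra_simps)
    qed
    moreover have "t \<noteq> 0"
    proof
      assume t: "t = 0"
      \<comment> \<open>Perturbing the strictly feasible slack by \<open>- d *\<^sub>R X\<close>
        leaves exactly that residual, so separation yields
        \<open>X \<bullet> X \<le> 0\<close>.\<close>
      obtain d where d: "d > 0" "C - L y0 - d *\<^sub>R X \<in> psd_cone"
        using pos_def_minus_scaled_psd[OF y0 Xsym] by (auto simp: L_def)
      have "0 \<le> - d * (X \<bullet> X)"
        using sep[OF d(2) zero_less_one, of y0] t by simp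
      then have "X \<bullet> X \<le> 0" using d(1) by (simp add: mult_le_0_iff)
      then have "X = 0" using inner_ge_zero[of X] inner_eq_zero_iff[of X] by linarith
      with t a(2) Xt show False by (simp add: zero_prod_def)
    qed
    ultimately have t: "t > 0" by simp
    have psdX: "X \<in> psd_cone"
    proof (rule psd_of_inner_nonneg[OF Xsym])
      fix S :: "real^'n^'n" assume S: "S \<in> psd_cone"
      show "0 \<le> X \<bullet> S"
      proof (rule nonneg_if_scaled_bounded_below)
        fix s :: real assume "0 < s"
        then show "- (X \<bullet> (- C + L 0) + t * (1 + p)) \<le> s * (X \<bullet> S)"
          using sep[OF psd_scale[OF S, of s] zero_less_one, of 0]
          by (simp add: inner_diff_right inner_add_right algebra_simps)
      qed
    qed
    have LA: "L (axis i 1) = A i" for i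
      by (simp add: L_def axis_def if_distrib[of "\<lambda>x. x *\<^sub>R _"] cong: if_cong)
    \<comment> \<open>Since \<open>y\<close> is free in sign, \<open>s\<close> ranges over all
      reals; boundedness below then forces the coefficient to vanish, which is the primal
      constraint.\<close>
    have yline: "- (X \<bullet> (- C) + t * (1 + p)) \<le> s * (X \<bullet> A i - t * b $ i)" for s i
      using sep[OF psd_0 zero_less_one, of "s *\<^sub>R axis i 1"]
      by (simp add: linear_scale[OF linL] LA inner_axis inner_diff_right inner_add_right algebra_simps)
    have feas: "A i \<bullet> ((1 / t) *\<^sub>R X) = b $ i" for i
    proof -
      have "0 \<le> X \<bullet> A i - t * b $ i"
        by (rule nonneg_if_scaled_bounded_below) (rule yline)
      moreover have "0 \<le> - (X \<bullet> A i - t * b $ i)"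
      proof (rule nonneg_if_scaled_bounded_below)
        fix s :: real
        show "- (X \<bullet> (- C) + t * (1 + p)) \<le> s * - (X \<bullet> A i - t * b $ i)"
          using yline[of "- s" i] by (simp add: right_diff_distrib)
      qed
      ultimately show ?thesis using t by (simp add: inner_commute[of X] field_simps)
    qed
    have "C \<bullet> X \<le> t * p"
    proof (rule field_le_epsilon)
      fix e :: real assume "0 < e"
      then show "C \<bullet> X \<le> t * p + e"
        using sep[OF psd_0, of "e / t" 0] t
        by (simp add: linear_0[OF linL] inner_commute algebra_simps)
    qed
    then have "C \<bullet> ((1 / t) *\<^sub>R X) \<le> p" using t by (simp add: field_simps)
    moreover have "primal_value A b C \<le> ereal (C \<bullet> ((1 / t) *\<^sub>R X))"
      using feas psdX t by (intro primal_value_le psd_scale) auto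
    ultimately show ?thesis using real by (metis ereal_less_eq(3) order_trans)
  qed
qed

section \<open>From asymptotic feasibility to strict feasibility of the perturbations\<close>

text \<open>Either form of asymptotic feasibility gives \<open>X\<close> in the cone and
  \<open>Y\<close> in \<open>V\<close> with \<open>X - Y\<close> small. Then
  \<open>Y + P = X + (P - (X - Y))\<close> is a semidefinite plus a positive definite
  matrix.\<close>

lemma asymptotically_feasible_shift_pos_def:
  assumes "asymptotically_feasible V" and "V \<subseteq> sym_mats" and "pos_def P"
  obtains Y where "Y \<in> V" "pos_def (Y + P)"
proof -
  let ?D = "{X - Y | X Y. X \<in> psd_cone \<and> Y \<in> V}"
  have "0 \<in> closure ?D"
  proof (cases "V \<inter> psd_cone = {}")
    case True
    then show ?thesis
      using assms(1) by (simp add: asymptotically_feasible_def weakly_infeasible_def)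
  next
    case False
    then obtain Y where "Y \<in> V" "Y \<in> psd_cone" by blast
    then have "Y - Y \<in> ?D" by blast
    then show ?thesis using subsetD[OF closure_subset, of "Y - Y" ?D] by simp
  qed
  moreover obtain d where d: "d > 0" "\<And>U. U \<in> sym_mats \<Longrightarrow> norm U < d \<Longrightarrow> pos_def (P - U)"
    using pos_def_perturb[OF assms(3)] by blast
  ultimately obtain Z where "Z \<in> ?D" "dist Z 0 < d"
    unfolding closure_approachable by blast
  then obtain X Y where XY: "X \<in> psd_cone" "Y \<in> V" "norm (X - Y) < d"
    by auto
  have "X - Y \<in> sym_mats"
    by (intro sym_mats_intros psd_sym XY subsetD[OF assms(2)])
  then have "pos_def (X + (P - (X - Y)))"
    using XY d(2) by (intro psd_add_pos_def) auto
  then have "pos_def (Y + P)" by (simp add: algebra_simps)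
  with XY show ?thesis using that by blast
qed

lemma perturbed_rhs_0: "perturbed_rhs A b P 0 = b"
  by (simp add: perturbed_rhs_def vec_eq_iff)

text \<open>The shifted element of the dual space is the slack of the same \<open>y\<close> for the
  perturbed cost, hence a Slater point.\<close>

lemma perturbed_values_eq_dual:
  assumes "C \<in> sym_mats" "\<And>i. A i \<in> sym_mats" "pos_def I\<^sub>d"
    and feas: "asymptotically_feasible (dual_space A C)" and e: "0 < \<epsilon>"
  shows "perturbed_primal_value A b C I\<^sub>p I\<^sub>d \<epsilon> 0 = perturbed_dual_value A b C I\<^sub>p I\<^sub>d \<epsilon> 0"
proof -
  obtain Y where Y: "Y \<in> dual_space A C" "pos_def (Y + \<epsilon> *\<^sub>R I\<^sub>d)"
    by (rule asymptotically_feasible_shift_pos_def[OF feas _ pos_def_scale[OF assms(3) e]])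
      (auto simp: dual_space_def)
  then obtain y where "Y = C - (\<Sum>i\<in>UNIV. y $ i *\<^sub>R A i)"
    by (auto simp: dual_space_def)
  with Y(2) have "pos_def (C + \<epsilon> *\<^sub>R I\<^sub>d - (\<Sum>i\<in>UNIV. y $ i *\<^sub>R A i))"
    by (simp add: algebra_simps)
  then show ?thesis
    unfolding perturbed_primal_value_def perturbed_dual_value_def
    using assms by (intro strong_duality_dual_interior) (auto simp: pos_def_def intro!: sym_mats_intros)
qed

text \<open>By linearity the shifted matrix satisfies the perturbed constraints, hence is a Slater
  point.\<close>

lemma perturbed_values_eq_primal:
  assumes "C \<in> sym_mats" "\<And>i. A i \<in> sym_mats" "pos_def I\<^sub>p"
    and feas: "asymptotically_feasible (primal_space A b)" and e: "0 < \<eta>"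
  shows "perturbed_primal_value A b C I\<^sub>p I\<^sub>d 0 \<eta> = perturbed_dual_value A b C I\<^sub>p I\<^sub>d 0 \<eta>"
proof -
  obtain X where X: "X \<in> primal_space A b" "pos_def (X + \<eta> *\<^sub>R I\<^sub>p)"
    by (rule asymptotically_feasible_shift_pos_def[OF feas _ pos_def_scale[OF assms(3) e]])
      (auto simp: primal_space_def)
  then have "A i \<bullet> (X + \<eta> *\<^sub>R I\<^sub>p) = perturbed_rhs A b I\<^sub>p \<eta> $ i" for i
    by (simp add: primal_space_def perturbed_rhs_def inner_add_right)
  then show ?thesis
    unfolding perturbed_primal_value_def perturbed_dual_value_def
    using assms X(2) by (intro strong_duality_primal_interior[where ?X0.0 = "X + \<eta> *\<^sub>R I\<^sub>p"]) auto
qed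

section \<open>Limits of the perturbed values\<close>

text \<open>From below, the added cost is nonnegative; from above, one nearly optimal
  \<open>X\<close> is kept fixed. Arguing by order covers infinite values as well.\<close>

lemma perturbed_primal_value_tendsto:
  assumes "pos_def I\<^sub>d"
  shows "((\<lambda>\<epsilon>. perturbed_primal_value A b C I\<^sub>p I\<^sub>d \<epsilon> 0) \<longlongrightarrow> primal_value A b C) (at_right 0)"
proof (rule order_tendstoI)
  fix a assume a: "a < primal_value A b C"
  have "primal_value A b C \<le> perturbed_primal_value A b C I\<^sub>p I\<^sub>d \<epsilon> 0" if "0 < \<epsilon>" for \<epsilon>
    unfolding perturbed_primal_value_def perturbed_rhs_0 primal_value_def
  proof (rule INF_mono)
    fix X assume X: "X \<in> {X \<in> psd_cone. \<forall>i. A i \<bullet> X = b $ i}"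
    then have "0 \<le> I\<^sub>d \<bullet> X" using psd_inner_nonneg pos_def_psd[OF assms] by auto
    then have "ereal (C \<bullet> X) \<le> ereal ((C + \<epsilon> *\<^sub>R I\<^sub>d) \<bullet> X)"
      using that by (simp add: inner_add_left)
    then show "\<exists>Y\<in>{X \<in> psd_cone. \<forall>i. A i \<bullet> X = b $ i}.
        ereal (C \<bullet> Y) \<le> ereal ((C + \<epsilon> *\<^sub>R I\<^sub>d) \<bullet> X)"
      using X by blast
  qed
  then show "\<forall>\<^sub>F \<epsilon> in at_right 0. a < perturbed_primal_value A b C I\<^sub>p I\<^sub>d \<epsilon> 0"
    using a by (auto intro!: eventually_at_right_less[THEN eventually_mono] intro: less_le_trans)
next
  fix a assume "primal_value A b C < a"
  then obtain X where X: "X \<in> psd_cone" "\<And>i. A i \<bullet> X = b $ i" "ereal (C \<bullet> X) < a"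
    unfolding primal_value_def INF_less_iff by auto
  have "((\<lambda>\<epsilon>. ereal ((C + \<epsilon> *\<^sub>R I\<^sub>d) \<bullet> X)) \<longlongrightarrow> ereal ((C + 0 *\<^sub>R I\<^sub>d) \<bullet> X)) (at_right 0)"
    by (intro tendsto_intros)
  then have "\<forall>\<^sub>F \<epsilon> in at_right 0. ereal ((C + \<epsilon> *\<^sub>R I\<^sub>d) \<bullet> X) < a"
    using X(3) by (intro order_tendstoD) auto
  then show "\<forall>\<^sub>F \<epsilon> in at_right 0. perturbed_primal_value A b C I\<^sub>p I\<^sub>d \<epsilon> 0 < a"
    unfolding perturbed_primal_value_def perturbed_rhs_0
    by (rule eventually_mono) (use primal_value_le[OF X(1,2)] in \<open>auto intro: le_less_trans\<close>)
qed

lemma perturbed_dual_value_tendsto: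
  assumes "pos_def I\<^sub>p"
  shows "((\<lambda>\<eta>. perturbed_dual_value A b C I\<^sub>p I\<^sub>d 0 \<eta>) \<longlongrightarrow> dual_value A b C) (at_right 0)"
proof (rule order_tendstoI)
  fix a assume "a < dual_value A b C"
  then obtain y where y: "C - (\<Sum>i\<in>UNIV. y $ i *\<^sub>R A i) \<in> psd_cone" "a < ereal (b \<bullet> y)"
    unfolding dual_value_def less_SUP_iff by auto
  have "((\<lambda>\<eta>. ereal (perturbed_rhs A b I\<^sub>p \<eta> \<bullet> y)) \<longlongrightarrow> ereal (perturbed_rhs A b I\<^sub>p 0 \<bullet> y)) (at_right 0)"
    unfolding perturbed_rhs_def by (intro tendsto_intros)
  then have "\<forall>\<^sub>F \<eta> in at_right 0. a < ereal (perturbed_rhs A b I\<^sub>p \<eta> \<bullet> y)"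
    using y(2) by (intro order_tendstoD) (auto simp: perturbed_rhs_0)
  then show "\<forall>\<^sub>F \<eta> in at_right 0. a < perturbed_dual_value A b C I\<^sub>p I\<^sub>d 0 \<eta>"
    unfolding perturbed_dual_value_def
    by (rule eventually_mono) (use dual_value_ge[OF y(1)] in \<open>auto intro: less_le_trans\<close>)
next
  fix a assume "dual_value A b C < a"
  \<comment> \<open>A real \<open>q\<close> stands in for the dual value, which may be infinite, so
    that the error term can be added in the reals.\<close>
  then obtain q where q: "dual_value A b C < ereal q" "ereal q < a"
    using ereal_dense2 by blast
  have bound: "perturbed_dual_value A b C I\<^sub>p I\<^sub>d 0 \<eta> \<le> ereal (q + \<eta> * (C \<bullet> I\<^sub>p))" if "0 < \<eta>" for \<eta>
    unfolding perturbed_dual_value_def dual_value_def[of _ "perturbed_rhs A b I\<^sub>p \<eta>"]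
  proof (rule SUP_least, clarsimp)
    fix y
    assume S: "C - (\<Sum>i\<in>UNIV. y $ i *\<^sub>R A i) \<in> psd_cone"
    have "ereal (b \<bullet> y) < ereal q"
      using dual_value_ge[OF S, of b] q(1) by (rule le_less_trans)
    \<comment> \<open>Nonnegativity of slack times \<open>I\<^sub>p\<close> bounds the gain in the
      objective by \<open>\<eta> * (C \<bullet> I\<^sub>p)\<close>, uniformly in
      \<open>y\<close>.\<close>
    moreover have "0 \<le> \<eta> * ((C - (\<Sum>i\<in>UNIV. y $ i *\<^sub>R A i)) \<bullet> I\<^sub>p)"
      using psd_inner_nonneg[OF S pos_def_psd[OF assms]] that by simp
    moreover have "perturbed_rhs A b I\<^sub>p \<eta> \<bullet> y = b \<bullet> y + \<eta> * ((\<Sum>i\<in>UNIV. y $ i *\<^sub>R A i) \<bullet> I\<^sub>p)"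
      by (simp add: perturbed_rhs_def inner_vec_def[of _ y] inner_sum_left sum_distrib_left
          sum.distrib algebra_simps)
    ultimately show "perturbed_rhs A b I\<^sub>p \<eta> \<bullet> y \<le> q + \<eta> * (C \<bullet> I\<^sub>p)"
      by (simp add: inner_diff_left right_diff_distrib)
  qed
  have "((\<lambda>\<eta>. ereal (q + \<eta> * (C \<bullet> I\<^sub>p))) \<longlongrightarrow> ereal (q + 0 * (C \<bullet> I\<^sub>p))) (at_right 0)"
    by (intro tendsto_intros)
  then have "\<forall>\<^sub>F \<eta> in at_right 0. ereal (q + \<eta> * (C \<bullet> I\<^sub>p)) < a"
    using q(2) by (intro order_tendstoD) auto
  with eventually_at_right_less[of "0::real"]
  show "\<forall>\<^sub>F \<eta> in at_right 0. perturbed_dual_value A b C I\<^sub>p I\<^sub>d 0 \<eta> < a"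
    by eventually_elim (use bound in \<open>auto intro: le_less_trans\<close>)
qed

theorem theorem3:
  fixes A :: "'m::finite \<Rightarrow> real^'n^'n"
    and b :: "real^'m"
    and C I\<^sub>p I\<^sub>d :: "real^'n^'n"
  assumes "C \<in> sym_mats"
    and "\<And>i. A i \<in> sym_mats"
    and "pos_def I\<^sub>p"
    and "pos_def I\<^sub>d"
  shows "(asymptotically_feasible (dual_space A C) \<longrightarrow>
           (\<forall>\<epsilon>>0. common_value A b C I\<^sub>p I\<^sub>d \<epsilon> 0 \<noteq> None) \<and>
           ((\<lambda>\<epsilon>. the (common_value A b C I\<^sub>p I\<^sub>d \<epsilon> 0)) \<longlongrightarrow> primal_value A b C) (at_right 0)) \<and>
         (asymptotically_feasible (primal_space A b) \<longrightarrow>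
           (\<forall>\<eta>>0. common_value A b C I\<^sub>p I\<^sub>d 0 \<eta> \<noteq> None) \<and>
           ((\<lambda>\<eta>. the (common_value A b C I\<^sub>p I\<^sub>d 0 \<eta>)) \<longlongrightarrow> dual_value A b C) (at_right 0))"
proof (intro conjI impI)
  assume feas: "asymptotically_feasible (dual_space A C)"
  have cv: "common_value A b C I\<^sub>p I\<^sub>d \<epsilon> 0 = Some (perturbed_primal_value A b C I\<^sub>p I\<^sub>d \<epsilon> 0)"
    if "0 < \<epsilon>" for \<epsilon>
    using perturbed_values_eq_dual[OF assms(1,2,4) feas that] by (simp add: common_value_def)
  show "\<forall>\<epsilon>>0. common_value A b C I\<^sub>p I\<^sub>d \<epsilon> 0 \<noteq> None" using cv by simp
  show "((\<lambda>\<epsilon>. the (common_value A b C I\<^sub>p I\<^sub>d \<epsilon> 0)) \<longlongrightarrow> primal_value A b C) (at_right 0)"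
    \<comment> \<open>The filter \<open>at_right 0\<close> sees only positive parameters, where the
      common value is defined.\<close>
    by (rule Lim_transform_eventually[OF perturbed_primal_value_tendsto[OF assms(4)]])
      (auto intro!: eventually_at_right_less[THEN eventually_mono] simp: cv)
next
  assume feas: "asymptotically_feasible (primal_space A b)"
  have cv: "common_value A b C I\<^sub>p I\<^sub>d 0 \<eta> = Some (perturbed_dual_value A b C I\<^sub>p I\<^sub>d 0 \<eta>)"
    if "0 < \<eta>" for \<eta>
    using perturbed_values_eq_primal[OF assms(1,2,3) feas that] by (simp add: common_value_def)
  show "\<forall>\<eta>>0. common_value A b C I\<^sub>p I\<^sub>d 0 \<eta> \<noteq> None" using cv by simp
  show "((\<lambda>\<eta>. the (common_value A b C I\<^sub>p I\<^sub>d 0 \<eta>)) \<longlongrightarrow> dual_value A b C) (at_right 0)"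
    by (rule Lim_transform_eventually[OF perturbed_dual_value_tendsto[OF assms(3)]])
      (auto intro!: eventually_at_right_less[THEN eventually_mono] simp: cv)
qed

end
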